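(* Let $S=\{s_1<\cdots<s_n\}$ be a non-empty set of positive integers, and let $\mathcal{B}_S$ be the collection of sets $\{a_1<\cdots<a_n\}$ of positive integers such that $a_1\le s_1,\ \ldots,\ a_n\le s_n$. Then $\mathcal{B}_S$ is the collection of bases of a matroid (on the ground set $[s_n]=\{1,\dots,s_n\}$).
   Context: The notation $\{a_1<\cdots<a_n\}$ means a set of $n$ distinct elements $a_1,\dots,a_n$ listed in increasing order. *)

theory Defs
  imports Main
begin

locale matroid =
  fixes E :: "'a set" and indep :: "'a set \<Rightarrow> bool"
  assumes finite_ground: "finite E"
    and indep_subset_ground: "indep X \<Longrightarrow> X \<subseteq> E"
    and indep_empty: "indep {}"
    and indep_mono: "indep Y \<Longrightarrow> X \<subseteq> Y \<Longrightarrow> indep X"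
    and augmentation: "indep X \<Longrightarrow> indep Y \<Longrightarrow> card X < card Y \<Longrightarrow>
      \<exists>y \<in> Y - X. indep (insert y X)"

definition bases_of :: "('a set \<Rightarrow> bool) \<Rightarrow> 'a set set" where
  "bases_of indep = {B. indep B \<and> (\<forall>X. indep X \<longrightarrow> B \<subseteq> X \<longrightarrow> X = B)}"

definition is_matroid_bases :: "'a set \<Rightarrow> 'a set set \<Rightarrow> bool" where
  "is_matroid_bases E \<B> \<longleftrightarrow> (\<exists>indep. matroid E indep \<and> bases_of indep = \<B>)"

(* List indices start at 0, so the (i+1)-st smallest element of a finite set A is
   sorted_list_of_set A ! i.  Finiteness of A is stated explicitly because
   card A = 0 and sorted_list_of_set A = [] for infinite A. *)
definition shifted_family :: "nat set \<Rightarrow> nat set set" where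
  "shifted_family S = {A. finite A \<and> (\<forall>a \<in> A. 0 < a) \<and> card A = card S \<and>
     (\<forall>i < card S. sorted_list_of_set A ! i \<le> sorted_list_of_set S ! i)}"

end

theory Submission
  imports Defs
begin

text \<open>
  For sets of equal size, the condition \<open>a\<^sub>i \<le> s\<^sub>i\<close> for all \<open>i\<close> says that no final segment
  \<open>{m<..}\<close> contains more elements of \<open>A\<close> than of \<open>S\<close>. Dropping the size condition gives the
  independent sets (a laminar matroid on a chain of segments). Let \<open>|X| < |Y|\<close> be independent and
  let \<open>t\<close> be the least \<open>m\<close> at which the bound for \<open>X\<close> is attained. Beyond \<open>t\<close> the set \<open>Y\<close> is no
  larger than \<open>X\<close>, so some \<open>y \<in> Y - X\<close> has \<open>y \<le> t\<close>; the bounds affected by adding it to \<open>X\<close> are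
  those at \<open>m < y\<close>, none of which is attained.
\<close>

text \<open>The list is increasing and without repetition, so the indices of entries at most
  \<open>m\<close> form an initial segment of the index range, and there are
  \<open>card (A \<inter> {..m})\<close> of them.\<close>

lemma sorted_list_of_set_nth_le_iff:
  fixes A :: "'a::linorder set"
  assumes "finite A" and "i < card A"
  shows "sorted_list_of_set A ! i \<le> m \<longleftrightarrow> i < card (A \<inter> {..m})"
proof -
  let ?xs = "sorted_list_of_set A"
  let ?J = "{j. j < card A \<and> ?xs ! j \<le> m}"
  have mono: "?xs ! j \<le> ?xs ! k" if "j \<le> k" "k < card A" for j k
    using that by (simp add: sorted_nth_mono)
  have "(!) ?xs ` {..<card A} = A"
    using assms(1) nth_image[of "card A" ?xs] by (simp add: atLeast0LessThan)
  moreover have "(!) ?xs ` {..<card A} \<inter> {..m} = (!) ?xs ` ?J"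
    by blast
  ultimately have "A \<inter> {..m} = (!) ?xs ` ?J"
    by metis
  moreover have "inj_on ((!) ?xs) ?J"
    by (auto intro!: inj_onI simp: nth_eq_iff_index_eq)
  ultimately have card: "card (A \<inter> {..m}) = card ?J"
    by (simp add: card_image)
  show ?thesis
  proof
    assume "?xs ! i \<le> m"
    have "j \<in> ?J" if "j \<le> i" for j
      using mono[OF that assms(2)] \<open>?xs ! i \<le> m\<close> that assms(2) by simp
    then have "{..i} \<subseteq> ?J"
      by blast
    then have "card {..i} \<le> card ?J"
      by (intro card_mono) auto
    then show "i < card (A \<inter> {..m})"
      by (simp add: card)
  next
    assume less: "i < card (A \<inter> {..m})"
    show "?xs ! i \<le> m"
    proof (rule ccontr)
      assume i: "\<not> ?xs ! i \<le> m"
      have "j < i" if "j \<in> ?J" for j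
      proof (rule ccontr)
        assume "\<not> j < i"
        then have "?xs ! i \<le> ?xs ! j"
          using mono that by simp
        with i that show False
          using order_trans by blast
      qed
      then have "?J \<subseteq> {..<i}"
        by blast
      then have "card ?J \<le> card {..<i}"
        by (intro card_mono) auto
      with less card show False
        by simp
    qed
  qed
qed

lemma card_Int_atMost_greaterThan:
  fixes A :: "'a::linorder set"
  assumes "finite A"
  shows "card A = card (A \<inter> {..m}) + card (A \<inter> {m<..})"
proof -
  have "A = (A \<inter> {..m}) \<union> (A \<inter> {m<..})"
    by auto
  then show ?thesis
    using assms by (metis (no_types, lifting) card_Un_disjoint disjoint_iff finite_Int Int_iff
        atMost_iff greaterThan_iff not_le)
qed

text \<open>The previous criterion turns comparison of entries into comparison of counts on initial
  segments; complements then give final segments.\<close>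

lemma sorted_list_of_set_le_iff_card_greaterThan_le:
  fixes A B :: "'a::linorder set"
  assumes "finite A" and "finite B" and card: "card A = card B"
  shows "(\<forall>i < card B. sorted_list_of_set A ! i \<le> sorted_list_of_set B ! i) \<longleftrightarrow>
    (\<forall>m. card (A \<inter> {m<..}) \<le> card (B \<inter> {m<..}))"
proof -
  have "(\<forall>i < card B. sorted_list_of_set A ! i \<le> sorted_list_of_set B ! i) \<longleftrightarrow>
    (\<forall>m. card (B \<inter> {..m}) \<le> card (A \<inter> {..m}))" (is "?L \<longleftrightarrow> ?R")
  proof
    assume L: ?L
    show ?R
    proof (rule ccontr)
      assume "\<not> ?R"
      then obtain m where less: "card (A \<inter> {..m}) < card (B \<inter> {..m})"
        by (auto simp: not_le)
      \<comment> \<open>As indices start at 0, entry \<open>?k\<close> of \<open>A\<close> is its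
        first one beyond \<open>m\<close>, while entry \<open>?k\<close> of \<open>B\<close> is
        still at most \<open>m\<close>.\<close>
      let ?k = "card (A \<inter> {..m})"
      have k: "?k < card B"
        using less card_mono[of B "B \<inter> {..m}"] assms(2) by auto
      have "sorted_list_of_set A ! ?k \<le> m"
        using L k less sorted_list_of_set_nth_le_iff[OF assms(2) k] order_trans by blast
      then show False
        using sorted_list_of_set_nth_le_iff[OF assms(1), of ?k m] k card by simp
    qed
  next
    assume R: ?R
    show ?L
    proof (intro allI impI)
      fix i assume i: "i < card B"
      \<comment> \<open>With this threshold the criterion for \<open>B\<close> holds trivially, and
        the resulting count passes to \<open>A\<close>.\<close>
      let ?m = "sorted_list_of_set B ! i"
      have "i < card (B \<inter> {..?m})"
        using sorted_list_of_set_nth_le_iff[OF assms(2) i, of ?m] by simp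
      also have "\<dots> \<le> card (A \<inter> {..?m})"
        using R by blast
      finally show "sorted_list_of_set A ! i \<le> ?m"
        using sorted_list_of_set_nth_le_iff[OF assms(1)] i card by simp
    qed
  qed
  \<comment> \<open>Both sets have the same total, so passing to complements reverses the
    inequality.\<close>
  moreover have "card (B \<inter> {..m}) \<le> card (A \<inter> {..m}) \<longleftrightarrow>
      card (A \<inter> {m<..}) \<le> card (B \<inter> {m<..})" for m
    using card_Int_atMost_greaterThan[OF assms(1), of m]
      card_Int_atMost_greaterThan[OF assms(2), of m] card by linarith
  ultimately show ?thesis
    by simp
qed

text \<open>Final segments give upper bounds, which subsets inherit; initial segments would give
  lower bounds, which they do not. Finiteness is explicit because \<open>card\<close> is 0 on
  infinite sets.\<close>

definition shifted_indep :: "nat set \<Rightarrow> nat set \<Rightarrow> bool" where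
  "shifted_indep S X \<longleftrightarrow> finite X \<and> (\<forall>x \<in> X. 0 < x) \<and>
     (\<forall>m. card (X \<inter> {m<..}) \<le> card (S \<inter> {m<..}))"

lemma shifted_indep_card_le:
  assumes "shifted_indep S X" and "finite S"
  shows "card X \<le> card S"
proof -
  \<comment> \<open>Elements are positive, so the bound at \<open>m = 0\<close> counts all of
    \<open>X\<close>.\<close>
  have "X \<inter> {0<..} = X"
    using assms(1) by (auto simp: shifted_indep_def)
  then have "card X \<le> card (S \<inter> {0<..})"
    using assms(1) unfolding shifted_indep_def by metis
  also have "\<dots> \<le> card S"
    using assms(2) by (intro card_mono) auto
  finally show ?thesis .
qed

lemma shifted_indep_subset:
  assumes "shifted_indep S X" and "finite S"
  shows "X \<subseteq> {1..Max S}"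
proof
  fix x assume x: "x \<in> X"
  have "S \<inter> {Max S<..} = {}"
    using Max_ge[OF assms(2)] by fastforce
  then have "card (X \<inter> {Max S<..}) = 0"
    using assms(1) unfolding shifted_indep_def by (metis card.empty le_zero_eq)
  \<comment> \<open>Finiteness of \<open>X\<close> excludes the default value 0 of
    \<open>card\<close>.\<close>
  then have "X \<inter> {Max S<..} = {}"
    using assms(1) by (simp add: shifted_indep_def)
  then show "x \<in> {1..Max S}"
    using x assms(1) by (fastforce simp: shifted_indep_def Suc_le_eq)
qed

lemma shifted_indep_mono:
  assumes "shifted_indep S Y" and "X \<subseteq> Y"
  shows "shifted_indep S X"
proof -
  have "card (X \<inter> {m<..}) \<le> card (Y \<inter> {m<..})" for m
    using assms by (intro card_mono) (auto simp: shifted_indep_def)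
  then show ?thesis
    using assms unfolding shifted_indep_def by (meson finite_subset order_trans subsetD)
qed

lemma shifted_indep_augmentation:
  assumes X: "shifted_indep S X" and Y: "shifted_indep S Y"
    and S: "finite S" and less: "card X < card Y"
  shows "\<exists>y \<in> Y - X. shifted_indep S (insert y X)"
proof -
  let ?tight = "\<lambda>m. card (X \<inter> {m<..}) = card (S \<inter> {m<..})"
  define t where "t = (LEAST m. ?tight m)"
  have fin: "finite X" "finite Y"
    using X Y by (auto simp: shifted_indep_def)
  \<comment> \<open>The bound is attained at \<open>Max S\<close>, as both sides are 0 there; hence
    the least such threshold exists.\<close>
  have "X \<inter> {Max S<..} = {}" "S \<inter> {Max S<..} = {}"
    using shifted_indep_subset[OF X S] Max_ge[OF S] by fastforce+
  then have "?tight (Max S)"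
    by simp
  then have tight: "?tight t"
    unfolding t_def by (rule LeastI)
  have "card (Y \<inter> {t<..}) \<le> card (X \<inter> {t<..})"
    using Y tight by (simp add: shifted_indep_def)
  then have "card (X \<inter> {..t}) < card (Y \<inter> {..t})"
    using less card_Int_atMost_greaterThan[OF fin(1), of t]
      card_Int_atMost_greaterThan[OF fin(2), of t] by linarith
  then have "\<not> Y \<inter> {..t} \<subseteq> X \<inter> {..t}"
    using card_mono[of "X \<inter> {..t}" "Y \<inter> {..t}"] fin by auto
  then obtain y where y: "y \<in> Y - X" "y \<le> t"
    by auto
  have "card (insert y X \<inter> {m<..}) \<le> card (S \<inter> {m<..})" for m
  proof (cases "m < y")
    case True
    then have "\<not> ?tight m"
      using y(2) not_less_Least[of m ?tight] unfolding t_def by simp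
    \<comment> \<open>The strict inequality leaves room for the single new element
      \<open>y\<close>.\<close>
    then have "card (X \<inter> {m<..}) < card (S \<inter> {m<..})"
      using X by (simp add: shifted_indep_def le_neq_implies_less)
    moreover have "insert y X \<inter> {m<..} = insert y (X \<inter> {m<..})"
      using True by auto
    ultimately show ?thesis
      using y(1) fin by simp
  next
    case False
    then have "insert y X \<inter> {m<..} = X \<inter> {m<..}"
      by auto
    then show ?thesis
      using X by (simp add: shifted_indep_def)
  qed
  then have "shifted_indep S (insert y X)"
    using X Y y(1) by (auto simp: shifted_indep_def)
  with y(1) show ?thesis
    by blast
qed

lemma matroid_shifted_indep:
  assumes "finite S"
  shows "matroid {1..Max S} (shifted_indep S)"
proof (rule matroid.intro)
  show "shifted_indep S {}"
    by (simp add: shifted_indep_def)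
  show "X \<subseteq> {1..Max S}" if "shifted_indep S X" for X
    using that assms by (rule shifted_indep_subset)
  show "shifted_indep S X" if "shifted_indep S Y" "X \<subseteq> Y" for X Y
    using that by (rule shifted_indep_mono)
  show "\<exists>y \<in> Y - X. shifted_indep S (insert y X)"
    if "shifted_indep S X" "shifted_indep S Y" "card X < card Y" for X Y
    using that(1,2) assms that(3) by (rule shifted_indep_augmentation)
qed simp

lemma shifted_family_eq:
  assumes "finite S"
  shows "shifted_family S = {A. shifted_indep S A \<and> card A = card S}"
  using sorted_list_of_set_le_iff_card_greaterThan_le[OF _ assms]
  unfolding shifted_family_def shifted_indep_def by blast

text \<open>Positivity makes \<open>S\<close> itself independent, and no independent set is larger.
  Augmentation from \<open>S\<close> therefore enlarges every independent set of smaller size, while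
  one of size \<open>card S\<close> has no proper independent superset.\<close>

lemma bases_of_shifted_indep:
  assumes "finite S" and "\<forall>s \<in> S. 0 < s"
  shows "bases_of (shifted_indep S) = {A. shifted_indep S A \<and> card A = card S}"
proof (intro set_eqI iffI)
  fix A assume "A \<in> bases_of (shifted_indep S)"
  then have A: "shifted_indep S A"
    and max: "\<And>X. shifted_indep S X \<Longrightarrow> A \<subseteq> X \<Longrightarrow> X = A"
    by (auto simp: bases_of_def)
  have "shifted_indep S S"
    using assms by (simp add: shifted_indep_def)
  then have "\<not> card A < card S"
    using shifted_indep_augmentation[OF A _ assms(1)] max by blast
  then show "A \<in> {A. shifted_indep S A \<and> card A = card S}"
    using A shifted_indep_card_le[OF A assms(1)] by simp
next
  fix A assume A: "A \<in> {A. shifted_indep S A \<and> card A = card S}"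
  have "X = A" if X: "shifted_indep S X" "A \<subseteq> X" for X
  proof -
    have "finite X" "card X \<le> card A"
      using X A shifted_indep_card_le[OF X(1) assms(1)] by (auto simp: shifted_indep_def)
    then show ?thesis
      using X(2) card_seteq by blast
  qed
  then show "A \<in> bases_of (shifted_indep S)"
    using A by (auto simp: bases_of_def)
qed

theorem theorem4p1:
  fixes S :: "nat set"
  assumes "finite S" and "S \<noteq> {}" and "\<forall>s \<in> S. 0 < s"
  shows "is_matroid_bases {1..Max S} (shifted_family S)"
proof -
  have "bases_of (shifted_indep S) = shifted_family S"
    using assms by (simp add: bases_of_shifted_indep shifted_family_eq)
  with matroid_shifted_indep[OF assms(1)] show ?thesis
    unfolding is_matroid_bases_def by blast
qed

end
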